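(* Let $G$ be a non-abelian (possibly infinite) group with exactly $n$ distinct element centralizers, $n$ a positive integer. If $n \leq 12$, then $\left|\frac{G}{Z(G)}\right| \leq (n-2)^2$; if $n > 12$, then $\left|\frac{G}{Z(G)}\right| \leq 2(n-4)^{\log_2(n-4)}$.
   Context: For a group $G$ and $x\in G$, $C(x)=\{g\in G : gx=xg\}$ is the centralizer of $x$ in $G$, and $\mathrm{Cent}(G)=\{C(x) : x\in G\}$ is the set of element centralizers of $G$ (it includes $G=C(1)$). $G$ is $n$-centralizer if $|\mathrm{Cent}(G)|=n$, with $n$ a finite positive integer. $Z(G)$ is the center of $G$. *)

theory Defs
  imports Complex_Main "HOL-Algebra.Coset"
begin

definition centralizer :: "('a, 'b) monoid_scheme \<Rightarrow> 'a \<Rightarrow> 'a set"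
  where "centralizer G x = {g \<in> carrier G. g \<otimes>\<^bsub>G\<^esub> x = x \<otimes>\<^bsub>G\<^esub> g}"

definition Cent :: "('a, 'b) monoid_scheme \<Rightarrow> 'a set set"
  where "Cent G = centralizer G ` carrier G"

definition center :: "('a, 'b) monoid_scheme \<Rightarrow> 'a set"
  where "center G = {z \<in> carrier G. \<forall>g \<in> carrier G. g \<otimes>\<^bsub>G\<^esub> z = z \<otimes>\<^bsub>G\<^esub> g}"

text \<open>Finiteness is explicit because \<^const>\<open>card\<close> is 0 on infinite sets.\<close>

definition n_centralizer :: "nat \<Rightarrow> ('a, 'b) monoid_scheme \<Rightarrow> bool"
  where "n_centralizer n G \<longleftrightarrow> n > 0 \<and> finite (Cent G) \<and> card (Cent G) = n"

lemma (in group) center_normal: "center G \<lhd> G"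
proof -
  have inv: "inv z \<in> center G" if z: "z \<in> center G" for z
  proof -
    have zc: "z \<in> carrier G" and comm: "\<And>g. g \<in> carrier G \<Longrightarrow> g \<otimes> z = z \<otimes> g"
      using z unfolding center_def by blast+
    have "g \<otimes> inv z = inv z \<otimes> g" if g: "g \<in> carrier G" for g
    proof -
      have "inv (z \<otimes> inv g) = inv (inv g \<otimes> z)" using comm[of "inv g"] g by simp
      then show ?thesis using g zc by (simp add: inv_mult_group)
    qed
    then show ?thesis using zc unfolding center_def by blast
  qed
  have sub: "subgroup (center G) G"
  proof (rule subgroupI)
    fix a b assume ab: "a \<in> center G" "b \<in> center G"
    have "g \<otimes> (a \<otimes> b) = (a \<otimes> b) \<otimes> g" if g: "g \<in> carrier G" for g
    proof -
      have c: "a \<in> carrier G" "b \<in> carrier G" "g \<otimes> a = a \<otimes> g" "g \<otimes> b = b \<otimes> g"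
        using ab g unfolding center_def by blast+
      have "g \<otimes> (a \<otimes> b) = (g \<otimes> a) \<otimes> b" by (rule m_assoc[OF g c(1,2), symmetric])
      also have "\<dots> = a \<otimes> (g \<otimes> b)" unfolding c(3) by (rule m_assoc[OF c(1) g c(2)])
      also have "\<dots> = (a \<otimes> b) \<otimes> g" unfolding c(4) by (rule m_assoc[OF c(1,2) g, symmetric])
      finally show ?thesis .
    qed
    moreover have "a \<otimes> b \<in> carrier G"
      using ab unfolding center_def by blast
    ultimately show "a \<otimes> b \<in> center G" unfolding center_def by blast
  next
    have "\<one> \<in> center G" by (simp add: center_def)
    then show "center G \<noteq> {}" by blast
  next
    show "center G \<subseteq> carrier G" by (auto simp: center_def)
  next
    fix a assume "a \<in> center G"
    then show "inv a \<in> center G" by (rule inv)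
  qed
  show ?thesis
  proof (rule normal_invI[OF sub])
    fix x h assume x: "x \<in> carrier G" and h: "h \<in> center G"
    have "h \<in> carrier G" "x \<otimes> h = h \<otimes> x" using x h unfolding center_def by blast+
    then have "x \<otimes> h \<otimes> inv x = h" using x by (simp add: m_assoc)
    then show "x \<otimes> h \<otimes> inv x \<in> center G" using h by simp
  qed
qed

end

theory Submission
  imports Defs
begin

text \<open>
  Let \<open>n\<close> be the number of centralizers and \<open>Z\<close> the center. Each \<open>y\<close> lies in the abelian
  subgroup \<open>Z(C(y))\<close>, so for non-central \<open>y\<close> at most \<open>n - 1\<close> such subgroups cover \<open>G - Z\<close>. If the
  image in \<open>G/Z\<close> of each of them has at most \<open>M\<close> elements, one of which is the identity, then
  \<open>|G/Z| \<le> 1 + (n - 1)(M - 1)\<close>. It remains to bound the image in \<open>G/Z\<close> of an abelian subgroup \<open>A\<close>;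
  this also yields the finiteness of \<open>G/Z\<close>.

  Choose a smallest finite set \<open>X\<close> such that only central elements of \<open>A\<close> commute with all of \<open>X\<close>,
  and let \<open>k = |X|\<close>. For \<open>g \<in> X\<close> let \<open>t(g)\<close> be the number of centralizers of elements of the coset
  \<open>Ag\<close>. When \<open>C(ag) = C(bg)\<close>, the elements \<open>ag\<close> and \<open>bg\<close> commute, hence so do \<open>ab\<^sup>-\<^sup>1\<close> and \<open>g\<close>.
  Thus the coset of \<open>a\<close> modulo \<open>Z\<close> is determined by the tuple of all \<open>C(ag)\<close>, \<open>g \<in> X\<close>, and
  the image of \<open>A\<close> has at most \<open>\<Prod>t(g)\<close> elements (\<open>card_image_center_le_prod\<close>).

  The \<open>t(g)\<close> and \<open>k\<close> cannot be large (\<open>card_Cent_ge\<close>). By minimality of \<open>X\<close> there are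
  \<open>b(g) \<in> A\<close>, \<open>g \<in> X\<close>, such that \<open>b(g)\<close> fails to commute with \<open>g\<close> but commutes with the other
  members of \<open>X\<close>. Multiplying over subsets \<open>S\<close> of \<open>X\<close> gives elements \<open>w(S)\<close> of \<open>G\<close> that
  commute with \<open>b(g)\<close> exactly when \<open>g \<notin> S\<close>. As \<open>A\<close> is abelian, all centralizers arising from
  the coset \<open>A w(S)\<close> meet \<open>A\<close> in the same set, which differs for different \<open>S\<close>; so distinct
  \<open>S\<close> contribute disjoint sets of centralizers. The singletons contribute \<open>\<Sum>t(g)\<close>, other non-empty
  subsets at least 2 each, and the empty one, that is \<open>A\<close> itself, at least \<open>2\<^sup>k\<close> via products of the
  \<open>b(g)\<close>. Altogether \<open>3 * 2\<^sup>k + \<Sum>t(g) \<le> n + 2k + 2\<close>.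

  For \<open>n \<le> 12\<close> this leaves \<open>k \<le> 2\<close> and implies \<open>\<Prod>t(g) \<le> n - 2\<close>, so that \<open>M = n - 2\<close> gives exactly
  \<open>1 + (n - 1)(n - 3) = (n - 2)\<^sup>2\<close>. For \<open>n > 12\<close> it gives \<open>2\<^sup>k\<^sup>+\<^sup>1 \<le> n - 4\<close>, and \<open>t(g) \<le> n - 4\<close> if
  \<open>k \<ge> 2\<close>, so that \<open>M = (n - 4)\<^sup>L\<^sup>-\<^sup>1\<close> with \<open>L = log\<^sub>2 (n - 4)\<close> serves, and \<open>n - 1 \<le> 2(n - 4)\<close> finishes.
\<close>

section \<open>Centralizers and dual families\<close>

text \<open>
  The noncommuting relation between the two families is the identity matrix. This is the
  multiplicative analogue of a pair of dual bases and plays the same part: products over index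
  sets separate all subsets.
\<close>

definition dual_families ::
  "('a, 'b) monoid_scheme \<Rightarrow> 'a set \<Rightarrow> ('a \<Rightarrow> 'a) \<Rightarrow> ('a \<Rightarrow> 'a) \<Rightarrow> bool"
  where "dual_families G X x y \<longleftrightarrow>
    (\<forall>i\<in>X. \<forall>j\<in>X. x i \<in> centralizer G (y j) \<longleftrightarrow> i \<noteq> j)"

context group
begin

lemma centralizer_subset: "centralizer G x \<subseteq> carrier G"
  by (auto simp: centralizer_def)

lemma centralizer_sym:
  "x \<in> carrier G \<Longrightarrow> y \<in> centralizer G x \<Longrightarrow> x \<in> centralizer G y"
  by (auto simp: centralizer_def)

lemma self_in_centralizer: "x \<in> carrier G \<Longrightarrow> x \<in> centralizer G x"
  by (simp add: centralizer_def)

lemma subgroup_centralizer: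
  assumes x: "x \<in> carrier G"
  shows "subgroup (centralizer G x) G"
proof (rule subgroupI)
  show "centralizer G x \<noteq> {}" using self_in_centralizer[OF x] by blast
next
  fix a assume a: "a \<in> centralizer G x"
  then have ac: "a \<in> carrier G" and e: "a \<otimes> x = x \<otimes> a" by (auto simp: centralizer_def)
  have "inv a \<otimes> x = inv a \<otimes> (x \<otimes> a) \<otimes> inv a" using ac x by (simp add: m_assoc)
  also have "\<dots> = x \<otimes> inv a" unfolding e[symmetric] using ac x by (simp add: m_assoc[symmetric])
  finally show "inv a \<in> centralizer G x" using ac by (simp add: centralizer_def)
next
  fix a b assume "a \<in> centralizer G x" "b \<in> centralizer G x"
  then have c: "a \<in> carrier G" "b \<in> carrier G" "a \<otimes> x = x \<otimes> a" "b \<otimes> x = x \<otimes> b"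
    by (auto simp: centralizer_def)
  have "a \<otimes> b \<otimes> x = a \<otimes> x \<otimes> b" using c(1,2,4) x by (simp add: m_assoc)
  also have "\<dots> = x \<otimes> (a \<otimes> b)" unfolding c(3) using c(1,2) x by (simp add: m_assoc)
  finally show "a \<otimes> b \<in> centralizer G x" using c by (simp add: centralizer_def)
qed (rule centralizer_subset)

lemma subgroup_mult_cancel_right:
  assumes H: "subgroup H G" and y: "y \<in> H" and z: "z \<in> carrier G"
  shows "z \<otimes> y \<in> H \<longleftrightarrow> z \<in> H"
proof
  assume "z \<otimes> y \<in> H"
  then have "z \<otimes> y \<otimes> inv y \<in> H" using H y by (simp add: subgroup.m_closed subgroup.m_inv_closed)
  then show "z \<in> H" using z y subgroup.mem_carrier[OF H] by (simp add: m_assoc)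
qed (use H y in \<open>simp add: subgroup.m_closed\<close>)

lemma subgroup_mult_cancel_left:
  assumes H: "subgroup H G" and y: "y \<in> H" and z: "z \<in> carrier G"
  shows "y \<otimes> z \<in> H \<longleftrightarrow> z \<in> H"
proof
  assume "y \<otimes> z \<in> H"
  then have "inv y \<otimes> (y \<otimes> z) \<in> H" using H y by (simp add: subgroup.m_closed subgroup.m_inv_closed)
  then show "z \<in> H" using z y subgroup.mem_carrier[OF H] by (simp add: m_assoc[symmetric])
qed (use H y in \<open>simp add: subgroup.m_closed\<close>)

lemma dual_families_sym:
  assumes "x ` X \<subseteq> carrier G" "y ` X \<subseteq> carrier G" "dual_families G X x y"
  shows "dual_families G X y x"
  using assms centralizer_sym unfolding dual_families_def image_subset_iff by metis

text \<open>
  The witness is the product of the \<open>x i\<close> over \<open>i \<in> S\<close>. All but one of its factors commute with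
  \<open>y i\<close>, so the product commutes with \<open>y i\<close> precisely if that factor is absent. Keeping it in a
  given subgroup \<open>H\<close> allows the lemma to be applied both inside an abelian subgroup and in the
  whole group.
\<close>

lemma dual_families_product:
  assumes "finite S" "S \<subseteq> X" and H: "subgroup H G"
    and x: "x ` X \<subseteq> H" and y: "y ` X \<subseteq> carrier G" and dual: "dual_families G X x y"
  shows "\<exists>h\<in>H. \<forall>j\<in>X. h \<in> centralizer G (y j) \<longleftrightarrow> j \<notin> S"
  using assms(1,2)
proof (induction S)
  case empty
  have "\<one> \<in> centralizer G (y j)" if "j \<in> X" for j
    using that y by (auto simp: centralizer_def)
  then show ?case using subgroup.one_closed[OF H] by blast
next
  case (insert i S)
  then obtain h where h: "h \<in> H" and hS: "\<forall>j\<in>X. h \<in> centralizer G (y j) \<longleftrightarrow> j \<notin> S" by auto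
  have i: "i \<in> X" "x i \<in> H" using insert x by auto
  have "h \<otimes> x i \<in> centralizer G (y j) \<longleftrightarrow> j \<notin> insert i S" if j: "j \<in> X" for j
  proof -
    have sub: "subgroup (centralizer G (y j)) G" using y j by (intro subgroup_centralizer) auto
    have car: "h \<in> carrier G" "x i \<in> carrier G" using h i H by (auto dest: subgroup.mem_carrier)
    show ?thesis
    proof (cases "j = i")
      case True
      then have "h \<in> centralizer G (y j)" "x i \<notin> centralizer G (y j)"
        using hS i insert dual by (auto simp: dual_families_def)
      then show ?thesis using subgroup_mult_cancel_left[OF sub] car True by simp
    next
      case False
      then have "x i \<in> centralizer G (y j)" using i j dual by (auto simp: dual_families_def)
      then show ?thesis using subgroup_mult_cancel_right[OF sub] car False hS j by simp
    qed
  qed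
  then show ?case using h i H by (meson subgroup.m_closed)
qed

end

section \<open>Centralizers of the elements of a coset of an abelian subgroup\<close>

definition translate_centralizers :: "('a, 'b) monoid_scheme \<Rightarrow> 'a set \<Rightarrow> 'a \<Rightarrow> 'a set set"
  where "translate_centralizers G A g = (\<lambda>a. centralizer G (a \<otimes>\<^bsub>G\<^esub> g)) ` A"

locale abelian_subgroup = group G + A?: subgroup A G
  for A and G (structure) +
  assumes commute: "a \<in> A \<Longrightarrow> b \<in> A \<Longrightarrow> a \<in> centralizer G b"
begin

text \<open>
  Both \<open>a \<otimes> g\<close> and \<open>b \<otimes> g\<close> lie in the common centralizer, so their quotient \<open>a \<otimes> inv b\<close> commutes with
  \<open>b \<otimes> g\<close>; it commutes with \<open>b\<close> too, and \<open>b\<close> can be cancelled.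
\<close>

lemma translate_eqD:
  assumes a: "a \<in> A" and b: "b \<in> A" and g: "g \<in> carrier G"
    and eq: "centralizer G (a \<otimes> g) = centralizer G (b \<otimes> g)"
  shows "a \<otimes> inv b \<in> centralizer G g"
proof -
  have car: "a \<in> carrier G" "b \<in> carrier G" using a b by auto
  have sub: "subgroup (centralizer G (b \<otimes> g)) G" using car g by (intro subgroup_centralizer) simp
  have "a \<otimes> g \<in> centralizer G (b \<otimes> g)" "b \<otimes> g \<in> centralizer G (b \<otimes> g)"
    using self_in_centralizer[of "a \<otimes> g"] self_in_centralizer[of "b \<otimes> g"] car g by (simp_all add: eq)
  then have "a \<otimes> g \<otimes> inv (b \<otimes> g) \<in> centralizer G (b \<otimes> g)"
    using sub by (simp add: subgroup.m_closed subgroup.m_inv_closed)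
  also have "a \<otimes> g \<otimes> inv (b \<otimes> g) = a \<otimes> (g \<otimes> inv g \<otimes> inv b)"
    using car g m_assoc[of a g "inv g \<otimes> inv b"] m_assoc[of g "inv g" "inv b"]
    by (simp add: inv_mult_group del: r_inv)
  also have "\<dots> = a \<otimes> inv b" using car g by simp
  finally have "b \<otimes> g \<in> centralizer G (a \<otimes> inv b)"
    using car g centralizer_sym[of "b \<otimes> g" "a \<otimes> inv b"] by simp
  moreover have "b \<in> centralizer G (a \<otimes> inv b)" using a b by (intro commute) auto
  moreover have "subgroup (centralizer G (a \<otimes> inv b)) G" using car by (intro subgroup_centralizer) simp
  ultimately have "g \<in> centralizer G (a \<otimes> inv b)" using subgroup_mult_cancel_left g by blast
  then show ?thesis using car centralizer_sym[of "a \<otimes> inv b" g] by simp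
qed

text \<open>
  Along a coset of \<open>A\<close>, centralizers vary but their intersection with \<open>A\<close> does not. This invariant
  tells the centralizers coming from different cosets apart.
\<close>

lemma translate_trace:
  assumes a: "a \<in> A" and b: "b \<in> A" and g: "g \<in> carrier G"
  shows "b \<in> centralizer G (a \<otimes> g) \<longleftrightarrow> b \<in> centralizer G g"
proof -
  have "a \<otimes> g \<in> centralizer G b \<longleftrightarrow> g \<in> centralizer G b"
    using subgroup_mult_cancel_left[OF subgroup_centralizer commute[OF a b]] b g by auto
  moreover have "b \<in> carrier G" "a \<otimes> g \<in> carrier G" using a b g by auto
  ultimately show ?thesis using g by (meson centralizer_sym)
qed

lemma translate_centralizers_subset:
  "g \<in> carrier G \<Longrightarrow> translate_centralizers G A g \<subseteq> Cent G"
  by (auto simp: translate_centralizers_def Cent_def)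

lemma disjoint_translate_centralizers:
  assumes g: "g \<in> carrier G" and h: "h \<in> carrier G" and b: "b \<in> A"
    and sep: "(b \<in> centralizer G g) \<noteq> (b \<in> centralizer G h)"
  shows "translate_centralizers G A g \<inter> translate_centralizers G A h = {}"
proof -
  have "(b \<in> C) = (b \<in> centralizer G g)" if "C \<in> translate_centralizers G A g" for C
    using that translate_trace[OF _ b g] by (auto simp: translate_centralizers_def)
  moreover have "(b \<in> C) = (b \<in> centralizer G h)" if "C \<in> translate_centralizers G A h" for C
    using that translate_trace[OF _ b h] by (auto simp: translate_centralizers_def)
  ultimately show ?thesis using sep by blast
qed

lemma two_translate_centralizers:
  assumes fin: "finite (Cent G)" and g: "g \<in> carrier G" and b: "b \<in> A" and nc: "b \<notin> centralizer G g"
  shows "2 \<le> card (translate_centralizers G A g)"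
proof -
  have ne: "centralizer G (b \<otimes> g) \<noteq> centralizer G (\<one> \<otimes> g)"
  proof
    assume "centralizer G (b \<otimes> g) = centralizer G (\<one> \<otimes> g)"
    from translate_eqD[OF b A.one_closed g this] show False using nc b by simp
  qed
  have "{centralizer G (b \<otimes> g), centralizer G (\<one> \<otimes> g)} \<subseteq> translate_centralizers G A g"
    unfolding translate_centralizers_def
    using imageI[OF b, of "\<lambda>a. centralizer G (a \<otimes> g)"]
      imageI[OF A.one_closed, of "\<lambda>a. centralizer G (a \<otimes> g)"] by simp
  then have "card {centralizer G (b \<otimes> g), centralizer G (\<one> \<otimes> g)} \<le> card (translate_centralizers G A g)"
    by (intro card_mono finite_subset[OF translate_centralizers_subset[OF g] fin])
  then show ?thesis using ne by simp
qed

section \<open>Counting centralizers\<close>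

text \<open>
  Each subset \<open>S\<close> of \<open>X\<close> yields an element \<open>w S\<close> whose coset accounts for a set \<open>T S\<close> of
  centralizers, and \<open>b\<close> witnesses that these sets are disjoint. The three terms of
  \<open>2\<^sup>k + \<Sum>t(g) + 2(2\<^sup>k - 1 - k) \<le> n\<close> come from \<open>S = {}\<close>, from the singletons, and from the
  remaining subsets, where \<open>k = |X|\<close>; the conclusion is this inequality without subtraction.
\<close>

lemma card_Cent_ge:
  assumes fin: "finite (Cent G)" and X: "finite X" "X \<subseteq> carrier G"
    and b: "b ` X \<subseteq> A" and dual: "dual_families G X b (\<lambda>g. g)"
  shows "3 * 2 ^ card X + (\<Sum>g\<in>X. card (translate_centralizers G A g)) \<le> card (Cent G) + 2 * card X + 2"
    and "g \<in> X \<Longrightarrow> 2 \<le> card (translate_centralizers G A g)"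
proof -
  have bcar: "b ` X \<subseteq> carrier G" using b by auto
  have dual': "dual_families G X (\<lambda>g. g) b"
    using dual_families_sym[OF bcar _ dual] X by simp
  have finS: "finite S" if "S \<subseteq> X" for S using that X finite_subset by blast
  define good where "good S g \<longleftrightarrow> g \<in> carrier G \<and> (\<forall>j\<in>X. g \<in> centralizer G (b j) \<longleftrightarrow> j \<notin> S)" for S g
  have ex: "\<exists>g. good S g" if "S \<subseteq> X" for S
    using dual_families_product[OF finS[OF that] that subgroup_self _ bcar dual'] X
    unfolding good_def by auto
  \<comment> \<open>On singletons the choice must be \<open>g\<close> itself, so that the sum over the given \<open>X\<close> appears;
      on the empty set it must be in \<open>A\<close>, so that \<open>T {}\<close> consists of the centralizers of \<open>A\<close>.\<close>
  define w where "w S = (if \<exists>g. S = {g} then the_elem S else if S = {} then \<one> else SOME g. good S g)" for S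
  have wgood: "good S (w S)" if S: "S \<subseteq> X" for S
  proof (cases "(\<exists>g. S = {g}) \<or> S = {}")
    case True
    then show ?thesis
      using S X dual' bcar subgroup.one_closed[OF subgroup_centralizer]
      by (auto simp: w_def good_def dual_families_def)
  next
    case False
    then show ?thesis using someI_ex[OF ex[OF S]] by (auto simp: w_def)
  qed
  have wcar: "w S \<in> carrier G" if "S \<subseteq> X" for S using wgood[OF that] by (simp add: good_def)
  have bw: "b j \<in> centralizer G (w S) \<longleftrightarrow> j \<notin> S" if "S \<subseteq> X" "j \<in> X" for S j
    using wgood[OF that(1)] that(2) bcar centralizer_sym[of "b j"] centralizer_sym[of "w S"]
    unfolding good_def by blast
  define T where "T S = translate_centralizers G A (w S)" for S
  have Tsub: "T S \<subseteq> Cent G" if "S \<subseteq> X" for S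
    using translate_centralizers_subset[OF wcar[OF that]] by (simp add: T_def)
  have Tfin: "finite (T S)" if "S \<subseteq> X" for S
    using finite_subset[OF Tsub[OF that] fin] .
  have disj: "T S \<inter> T S' = {}" if S: "S \<subseteq> X" "S' \<subseteq> X" "S \<noteq> S'" for S S'
  proof -
    obtain j where j: "j \<in> X" "(j \<in> S) \<noteq> (j \<in> S')" using S by blast
    show ?thesis unfolding T_def
      using j b bw S by (intro disjoint_translate_centralizers[where b = "b j"] wcar) auto
  qed
  have two: "2 \<le> card (T S)" if S: "S \<subseteq> X" "S \<noteq> {}" for S
  proof -
    obtain j where "j \<in> S" using S by blast
    then show ?thesis unfolding T_def
      using S b bw[OF S(1)] by (intro two_translate_centralizers[where b = "b j"] fin wcar) auto
  qed
  have w1: "w {g} = g" for g by (auto simp: w_def)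
  show "2 \<le> card (translate_centralizers G A g)" if "g \<in> X" for g
    using two[of "{g}"] that by (simp add: T_def w1)
  have "2 ^ card X \<le> card (T {})"
  proof -
    \<comment> \<open>Products of the \<open>b g\<close> stay in \<open>A\<close> and their centralizers cut out every subset of \<open>X\<close>.\<close>
    have "\<exists>a\<in>A. \<forall>j\<in>X. a \<in> centralizer G j \<longleftrightarrow> j \<notin> S" if S: "S \<subseteq> X" for S
      using dual_families_product[OF finS[OF S] S A.subgroup_axioms b _ dual] X by simp
    then obtain c where c: "\<And>S. S \<subseteq> X \<Longrightarrow> c S \<in> A \<and> (\<forall>j\<in>X. c S \<in> centralizer G j \<longleftrightarrow> j \<notin> S)"
      by metis
    have tr: "X - centralizer G (c S) = S" if S: "S \<subseteq> X" for S
    proof -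
      have "c S \<in> carrier G" using c[OF S] by auto
      then have "j \<in> centralizer G (c S) \<longleftrightarrow> j \<notin> S" if "j \<in> X" for j
        using c[OF S] that X centralizer_sym[of j] centralizer_sym[of "c S"] by blast
      then show ?thesis using S by blast
    qed
    have "inj_on (\<lambda>S. centralizer G (c S)) (Pow X)"
      by (rule inj_on_inverseI[where g = "\<lambda>C. X - C"]) (use tr in auto)
    moreover have "(\<lambda>S. centralizer G (c S)) ` Pow X \<subseteq> T {}"
      using c by (auto simp: T_def w_def translate_centralizers_def image_iff intro!: bexI)
    ultimately have "card (Pow X) \<le> card (T {})"
      using Tfin[of "{}"] by (intro card_inj_on_le) auto
    then show ?thesis using X by (simp add: card_Pow)
  qed
  define P1 where "P1 = (\<lambda>g. {g}) ` X"
  define P2 where "P2 = Pow X - insert {} P1"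
  have P1: "finite P1" "P1 \<subseteq> Pow X" "card P1 = card X" "{} \<notin> P1"
    using X by (auto simp: P1_def card_image)
  have P2: "finite P2" using X by (simp add: P2_def)
  have cardP: "2 ^ card X = 1 + card X + card P2"
  proof -
    have "card (Pow X) = card (insert {} P1) + card P2"
      unfolding P2_def using X P1
      by (subst card_Un_disjoint[symmetric]) (auto intro!: arg_cong[where f = card])
    then show ?thesis using X P1 by (simp add: card_Pow)
  qed
  have "card (T {}) + ((\<Sum>S\<in>P1. card (T S)) + (\<Sum>S\<in>P2. card (T S))) = (\<Sum>S\<in>Pow X. card (T S))"
  proof -
    have "Pow X = insert {} (P1 \<union> P2)" "{} \<notin> P1 \<union> P2" "P1 \<inter> P2 = {}"
      using P1 by (auto simp: P2_def)
    then show ?thesis using P1(1) P2 by (simp add: sum.union_disjoint)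
  qed
  also have "\<dots> = card (\<Union>S\<in>Pow X. T S)"
    using X Tfin disj by (intro card_UN_disjoint[symmetric]) auto
  also have "\<dots> \<le> card (Cent G)" using Tsub by (intro card_mono fin) auto
  finally have le: "card (T {}) + ((\<Sum>S\<in>P1. card (T S)) + (\<Sum>S\<in>P2. card (T S))) \<le> card (Cent G)" .
  have "(\<Sum>S\<in>P2. 2) \<le> (\<Sum>S\<in>P2. card (T S))"
    by (rule sum_mono) (use two in \<open>auto simp: P2_def\<close>)
  moreover have "(\<Sum>S\<in>P1. card (T S)) = (\<Sum>g\<in>X. card (translate_centralizers G A g))"
    unfolding P1_def by (subst sum.reindex) (auto simp: T_def w1)
  ultimately show "3 * 2 ^ card X + (\<Sum>g\<in>X. card (translate_centralizers G A g)) \<le> card (Cent G) + 2 * card X + 2"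
    using le \<open>2 ^ card X \<le> card (T {})\<close> cardP by simp
qed

section \<open>The image of an abelian subgroup modulo the center\<close>

lemma r_coset_center_eqI:
  assumes "a \<in> carrier G" "b \<in> carrier G" "a \<otimes> inv b \<in> center G"
  shows "center G #> a = center G #> b"
proof -
  have sub: "subgroup (center G) G" using center_normal by (rule normal_imp_subgroup)
  have "a \<in> center G #> b"
    using assms unfolding r_coset_def by (auto simp: m_assoc intro!: bexI[where x = "a \<otimes> inv b"])
  then show ?thesis using repr_independence[OF _ assms(2) sub] by simp
qed

text \<open>
  The map sending \<open>a\<close> to the tuple of centralizers \<open>C(a \<otimes> g)\<close>, \<open>g \<in> X\<close>, can only identify elements
  whose quotient commutes with every \<open>g \<in> X\<close>, by \<open>translate_eqD\<close>, and such a quotient is central.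
  So the coset of \<open>a\<close> is recovered from any preimage \<open>r\<close> of the tuple of \<open>a\<close>.
\<close>

lemma card_image_center_le_prod:
  assumes fin: "finite (Cent G)" and X: "finite X" "X \<subseteq> carrier G"
    and cut: "A \<inter> (\<Inter>g\<in>X. centralizer G g) \<subseteq> center G"
  shows "finite ((\<lambda>a. center G #> a) ` A)"
    and "card ((\<lambda>a. center G #> a) ` A) \<le> (\<Prod>g\<in>X. card (translate_centralizers G A g))"
proof -
  let ?q = "\<lambda>a. center G #> a"
  define f where "f a = (\<lambda>g\<in>X. centralizer G (a \<otimes> g))" for a
  define r where "r u = (SOME a. a \<in> A \<and> f a = u)" for u
  have fin': "finite (PiE X (translate_centralizers G A))"
    using X fin finite_subset[OF translate_centralizers_subset] by (intro finite_PiE) auto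
  have fA: "f ` A \<subseteq> PiE X (translate_centralizers G A)"
    by (auto simp: f_def translate_centralizers_def)
  have "?q a = ?q (r (f a))" if a: "a \<in> A" for a
  proof -
    have r: "r (f a) \<in> A" "f (r (f a)) = f a"
      using someI[of "\<lambda>c. c \<in> A \<and> f c = f a" a] a by (auto simp: r_def)
    have "a \<otimes> inv (r (f a)) \<in> centralizer G g" if g: "g \<in> X" for g
      using fun_cong[OF r(2), of g] g X a r(1) by (intro translate_eqD) (auto simp: f_def)
    then have "a \<otimes> inv (r (f a)) \<in> center G" using cut a r(1) by auto
    then show ?thesis using a r(1) by (intro r_coset_center_eqI) auto
  qed
  then have sub: "?q ` A \<subseteq> (\<lambda>u. ?q (r u)) ` (f ` A)" by auto
  have finf: "finite (f ` A)" using finite_subset[OF fA fin'] .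
  then show "finite (?q ` A)" using finite_subset[OF sub] by simp
  have "card (?q ` A) \<le> card (f ` A)" using surj_card_le[OF finf sub] .
  also have "\<dots> \<le> card (PiE X (translate_centralizers G A))" using card_mono[OF fin' fA] .
  also have "\<dots> = (\<Prod>g\<in>X. card (translate_centralizers G A g))" using X by (simp add: card_PiE)
  finally show "card (?q ` A) \<le> (\<Prod>g\<in>X. card (translate_centralizers G A g))" .
qed

text \<open>
  A finite \<open>X\<close> exists because representatives of the finitely many centralizers already cut \<open>A\<close> down
  to central elements. If \<open>X\<close> has least cardinality, leaving out \<open>g\<close> lets in a non-central element
  \<open>b g\<close> of \<open>A\<close>; it commutes with the rest of \<open>X\<close>, hence not with \<open>g\<close>.
\<close>

lemma exists_minimal_cut:
  assumes fin: "finite (Cent G)"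
  obtains X b where "finite X" "X \<subseteq> carrier G" "A \<inter> (\<Inter>g\<in>X. centralizer G g) \<subseteq> center G"
    "b ` X \<subseteq> A" "dual_families G X b (\<lambda>g. g)"
proof -
  let ?cut = "\<lambda>X. A \<inter> (\<Inter>g\<in>X. centralizer G g) \<subseteq> center G"
  let ?P = "\<lambda>X. finite X \<and> X \<subseteq> carrier G \<and> ?cut X"
  obtain X0 where X0: "X0 \<subseteq> carrier G" "finite X0" "centralizer G ` X0 = Cent G"
    using finite_subset_image[OF fin, of "centralizer G" "carrier G"] by (auto simp: Cent_def)
  have "z \<in> center G" if z: "z \<in> A" "\<forall>g\<in>X0. z \<in> centralizer G g" for z
  proof -
    have "z \<in> centralizer G g" if "g \<in> carrier G" for g
    proof -
      have "centralizer G g \<in> centralizer G ` X0" using X0(3) that by (simp add: Cent_def)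
      then show ?thesis using z(2) by auto
    qed
    then show ?thesis using z(1) by (auto simp: center_def centralizer_def)
  qed
  then have "?cut X0" by blast
  then have "?P X0" using X0 by blast
  then obtain X where X: "?P X" and mini: "\<And>Y. ?P Y \<Longrightarrow> card X \<le> card Y"
    using ex_has_least_nat[of ?P X0 card] by blast
  have "\<exists>b\<in>A. b \<notin> centralizer G g \<and> (\<forall>h\<in>X - {g}. b \<in> centralizer G h)" if g: "g \<in> X" for g
  proof -
    have "card (X - {g}) < card X" using X g by (intro card_Diff1_less) auto
    then have "\<not> ?cut (X - {g})" using mini[of "X - {g}"] X by auto
    then obtain b where b: "b \<in> A" "\<forall>h\<in>X - {g}. b \<in> centralizer G h" "b \<notin> center G" by auto
    then have "b \<notin> centralizer G g" using X by (auto simp: subset_iff)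
    then show ?thesis using b by auto
  qed
  then obtain b where b: "\<And>g. g \<in> X \<Longrightarrow> b g \<in> A \<and> b g \<notin> centralizer G g \<and> (\<forall>h\<in>X - {g}. b g \<in> centralizer G h)"
    by metis
  show thesis using X b by (intro that[of X b]) (auto simp: dual_families_def)
qed

lemma finite_image_center:
  assumes "finite (Cent G)"
  shows "finite ((\<lambda>a. center G #> a) ` A)"
  using exists_minimal_cut[OF assms] card_image_center_le_prod(1)[OF assms] by metis

text \<open>
  Since all \<open>t g \<ge> 2\<close>, the inequality of \<open>card_Cent_ge\<close> bounds a single one by \<open>n + 4 - 3 * 2\<^sup>k\<close>, and
  hence \<open>3 * 2\<^sup>k \<le> n + 2\<close>. For \<open>n \<le> 12\<close> only \<open>k = 2\<close> needs more: there \<open>t g + t h \<le> n - 6\<close>, and the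
  product is controlled by the arithmetic-geometric mean inequality.
\<close>

lemma card_image_center_le:
  assumes fin: "finite (Cent G)" and n: "n = card (Cent G)" "3 \<le> n"
  shows "n \<le> 12 \<Longrightarrow> card ((\<lambda>a. center G #> a) ` A) \<le> n - 2"
    and "12 < n \<Longrightarrow> real (card ((\<lambda>a. center G #> a) ` A)) \<le> (real n - 4) powr (log 2 (real n - 4) - 1)"
proof -
  obtain X b where X: "finite X" "X \<subseteq> carrier G"
    and cut: "A \<inter> (\<Inter>g\<in>X. centralizer G g) \<subseteq> center G"
    and b: "b ` X \<subseteq> A" "dual_families G X b (\<lambda>g. g)"
    using exists_minimal_cut[OF fin] by metis
  define k where "k = card X"
  define t where "t g = card (translate_centralizers G A g)" for g
  define a where "a = card ((\<lambda>a. center G #> a) ` A)"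
  have a: "a \<le> (\<Prod>g\<in>X. t g)"
    unfolding a_def t_def by (rule card_image_center_le_prod(2)[OF fin X cut])
  have count: "3 * 2 ^ k + (\<Sum>g\<in>X. t g) \<le> n + 2 * k + 2"
    using card_Cent_ge(1)[OF fin X b] by (simp add: t_def k_def n)
  have t2: "2 \<le> t g" if "g \<in> X" for g
    using card_Cent_ge(2)[OF fin X b that] by (simp add: t_def)
  have t_le: "3 * 2 ^ k + t g \<le> n + 4" if g: "g \<in> X" for g
  proof -
    have "card (X - {g}) * 2 \<le> (\<Sum>h\<in>X - {g}. t h)"
      using sum_bounded_below[of "X - {g}" 2 t] t2 by simp
    moreover have "(\<Sum>h\<in>X. t h) = t g + (\<Sum>h\<in>X - {g}. t h)" using X g by (simp add: sum.remove)
    moreover have "card (X - {g}) + 1 = k"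
      using X g card_Suc_Diff1[of X g] by (simp add: k_def)
    ultimately show ?thesis using count by linarith
  qed
  have k0: "a \<le> 1" if "k = 0" using a that X by (simp add: k_def)
  have k1: "a \<le> n - 2" if "k = 1"
  proof -
    obtain g where "X = {g}" using \<open>k = 1\<close> by (auto simp: k_def card_Suc_eq)
    then show ?thesis using a t_le[of g] that by simp
  qed
  have pow: "3 * 2 ^ k \<le> n + 2" if k: "k \<noteq> 0"
  proof -
    obtain g where g: "g \<in> X" using k X by (auto simp: k_def)
    show ?thesis using t_le[OF g] t2[OF g] by simp
  qed
  have k2: "2 \<le> k \<Longrightarrow> 12 \<le> 3 * (2::nat) ^ k" and k3: "3 \<le> k \<Longrightarrow> 24 \<le> 3 * (2::nat) ^ k"
    using power_increasing[of 2 k "2::nat"] power_increasing[of 3 k "2::nat"] by simp_all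
  show "card ((\<lambda>a. center G #> a) ` A) \<le> n - 2" if n12: "n \<le> 12"
  proof -
    have "k < 3" using pow k3 n12 by (cases "3 \<le> k") auto
    then consider "k = 0" | "k = 1" | "k = 2" by linarith
    then have "a \<le> n - 2"
    proof cases
      case 3
      then obtain g h where gh: "X = {g, h}" "g \<noteq> h" by (auto simp: k_def card_2_iff)
      have "12 + (t g + t h) \<le> n + 6" using count gh 3 by simp
      then have s: "t g + t h \<le> n - 6" by simp
      have "4 * a \<le> 4 * (t g * t h)" using a gh by simp
      also have "\<dots> \<le> (t g + t h)\<^sup>2"
      proof -
        have "0 \<le> (int (t g) - int (t h))\<^sup>2" by simp
        then have "int (4 * (t g * t h)) \<le> int ((t g + t h)\<^sup>2)" by (simp add: power2_eq_square algebra_simps)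
        then show ?thesis by linarith
      qed
      also have "\<dots> \<le> (n - 6)\<^sup>2" using s by (rule power_mono) simp
      \<comment> \<open>This quadratic inequality breaks down at \<open>n = 13\<close>.\<close>
      also have "\<dots> \<le> 4 * (n - 2)"
      proof -
        have "10 \<le> n" using pow 3 by simp
        then have "n = 10 \<or> n = 11 \<or> n = 12" using n12 by linarith
        then show ?thesis by auto
      qed
      finally show ?thesis by simp
    qed (use k0 k1 n in auto)
    then show ?thesis by (simp add: a_def)
  qed
  show "real (card ((\<lambda>a. center G #> a) ` A)) \<le> (real n - 4) powr (log 2 (real n - 4) - 1)" if n12: "12 < n"
  proof -
    let ?L = "log 2 (real n - 4)"
    have L: "real j + 1 \<le> ?L" if "2 ^ (j + 1) \<le> n - 4" for j :: nat
    proof -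
      have "real (2 ^ (j + 1)) \<le> real (n - 4)" using that by (simp only: of_nat_le_iff)
      then have "2 powr (real j + 1) \<le> real n - 4" using n12 by (simp add: powr_add powr_realpow)
      then show ?thesis using n12 by (subst le_log_iff) auto
    qed
    have up: "real c \<le> (real n - 4) powr (?L - 1)" if c: "c \<le> (n - 4) ^ j" and j: "2 ^ (j + 1) \<le> n - 4" for c j
    proof -
      have "real c \<le> real ((n - 4) ^ j)" using c by (simp only: of_nat_le_iff)
      also have "\<dots> = (real n - 4) powr real j" using n12 by (simp add: powr_realpow of_nat_diff)
      also have "\<dots> \<le> (real n - 4) powr (?L - 1)" using L[OF j] n12 by (intro powr_mono) auto
      finally show ?thesis .
    qed
    \<comment> \<open>For \<open>k = 1\<close> the only available bound is \<open>n - 2\<close>, which exceeds \<open>n - 4\<close>; the exponent 2 is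
        used instead, which is affordable since \<open>2\<^sup>3 \<le> n - 4\<close>.\<close>
    consider "k < 2" | "2 \<le> k" by linarith
    then have "real a \<le> (real n - 4) powr (?L - 1)"
    proof cases
      case 1
      then have "a \<le> n - 2" using k0 k1 n12 by (cases "k = 0") auto
      also have "n - 2 \<le> 9 * (n - 4)" using n12 by simp
      also have "\<dots> \<le> (n - 4) * (n - 4)" using n12 by (intro mult_right_mono) auto
      finally show ?thesis using n12 by (intro up[where j = 2]) (auto simp: power2_eq_square)
    next
      case 2
      have "t g \<le> n - 4" if "g \<in> X" for g using t_le[OF that] k2[OF 2] by linarith
      then have "(\<Prod>g\<in>X. t g) \<le> (\<Prod>g\<in>X. n - 4)" by (intro prod_mono) simp
      then have "a \<le> (n - 4) ^ k" using a by (simp add: k_def)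
      moreover have "2 ^ (k + 1) \<le> n - 4"
        using pow 2 k3 n12 by (cases "k = 2") auto
      ultimately show ?thesis by (rule up)
    qed
    then show ?thesis by (simp add: a_def)
  qed
qed

end

section \<open>Covering the central quotient\<close>

context group
begin

text \<open>For \<open>C = C(x)\<close> this double centralizer of \<open>x\<close> is the center of the group \<open>C(x)\<close>.\<close>

definition common_centralizer :: "'a set \<Rightarrow> 'a set"
  where "common_centralizer C = (\<Inter>c\<in>C. centralizer G c)"

lemma abelian_subgroup_common_centralizer:
  assumes "C \<in> Cent G"
  shows "abelian_subgroup (common_centralizer C) G"
proof -
  obtain x where x: "x \<in> carrier G" and C: "C = centralizer G x"
    using assms by (auto simp: Cent_def)
  have xC: "x \<in> C" using self_in_centralizer[OF x] C by simp
  have "subgroup (\<Inter> (centralizer G ` C)) G"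
    using xC centralizer_subset[of x] C
    by (intro subgroups_Inter) (auto intro!: subgroup_centralizer)
  then have sub: "subgroup (common_centralizer C) G" by (simp add: common_centralizer_def)
  have "a \<in> centralizer G b" if "a \<in> common_centralizer C" "b \<in> common_centralizer C" for a b
  proof -
    have "b \<in> C" using that(2) xC C by (simp add: common_centralizer_def)
    then show ?thesis using that(1) by (simp add: common_centralizer_def)
  qed
  then show ?thesis
    by (intro abelian_subgroup.intro abelian_subgroup_axioms.intro is_group sub)
qed

lemma mem_common_centralizer:
  "y \<in> carrier G \<Longrightarrow> y \<in> common_centralizer (centralizer G y)"
  by (simp add: common_centralizer_def centralizer_sym)

lemma centralizer_eq_carrier_iff:
  "z \<in> carrier G \<Longrightarrow> centralizer G z = carrier G \<longleftrightarrow> z \<in> center G"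
  unfolding center_def centralizer_def by auto

lemma carrier_Mod_center_cover:
  "carrier (G Mod center G) \<subseteq> insert (center G)
     (\<Union>C\<in>Cent G - {carrier G}. (\<lambda>a. center G #> a) ` common_centralizer C - {center G})"
proof
  fix u assume "u \<in> carrier (G Mod center G)"
  then obtain y where y: "y \<in> carrier G" "u = center G #> y"
    by (auto simp: FactGroup_def RCOSETS_def)
  show "u \<in> insert (center G)
     (\<Union>C\<in>Cent G - {carrier G}. (\<lambda>a. center G #> a) ` common_centralizer C - {center G})"
  proof (cases "u = center G")
    case False
    have sub: "subgroup (center G) G" using center_normal by (rule normal_imp_subgroup)
    have "y \<notin> center G" using False y coset_join2[OF _ sub] by auto
    then have "centralizer G y \<in> Cent G - {carrier G}"
      using y centralizer_eq_carrier_iff by (auto simp: Cent_def)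
    then show ?thesis using False y mem_common_centralizer by blast
  qed simp
qed

text \<open>
  One of the centralizers is \<open>G\<close> itself and belongs to the central elements; each of the others
  contributes at most \<open>M - 1\<close> cosets besides the trivial one, which is counted once.
\<close>

lemma order_Mod_center_le:
  assumes fin: "finite (Cent G)"
    and M: "\<And>C. C \<in> Cent G \<Longrightarrow> real (card ((\<lambda>a. center G #> a) ` common_centralizer C)) \<le> M"
  shows "finite (carrier (G Mod center G))"
    and "real (order (G Mod center G)) \<le> 1 + (real (card (Cent G)) - 1) * (M - 1)"
proof -
  define Q where "Q C = (\<lambda>a. center G #> a) ` common_centralizer C" for C
  have finQ: "finite (Q C)" if "C \<in> Cent G" for C
    unfolding Q_def
    by (rule abelian_subgroup.finite_image_center[OF abelian_subgroup_common_centralizer[OF that] fin])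
  have zQ: "center G \<in> Q C" if "C \<in> Cent G" for C
  proof -
    interpret A: abelian_subgroup "common_centralizer C" G
      by (rule abelian_subgroup_common_centralizer[OF that])
    have "center G = center G #> \<one>" by (simp add: center_def subset_iff)
    then show ?thesis using A.A.one_closed by (auto simp: Q_def)
  qed
  define U where "U = (\<Union>C\<in>Cent G - {carrier G}. Q C - {center G})"
  have cover: "carrier (G Mod center G) \<subseteq> insert (center G) U"
    using carrier_Mod_center_cover by (simp add: U_def Q_def)
  have finU: "finite U" using fin finQ by (auto simp: U_def)
  then show "finite (carrier (G Mod center G))" using cover finite_subset by blast
  have "carrier G \<in> Cent G"
  proof -
    have "centralizer G \<one> = carrier G" by (auto simp: centralizer_def)
    then show ?thesis unfolding Cent_def by (metis imageI one_closed)
  qed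
  then have c1: "real (card (Cent G - {carrier G})) = real (card (Cent G)) - 1"
    using fin card_Suc_Diff1[OF fin, of "carrier G"] by linarith
  have "order (G Mod center G) \<le> card (insert (center G) U)"
    unfolding order_def using finU by (intro card_mono cover) simp
  also have "\<dots> \<le> 1 + card U" using card_Un_le[of "{center G}" U] by simp
  also have "\<dots> \<le> 1 + (\<Sum>C\<in>Cent G - {carrier G}. card (Q C - {center G}))"
    unfolding U_def using fin by (intro add_left_mono card_UN_le) simp
  finally have "real (order (G Mod center G))
      \<le> real (1 + (\<Sum>C\<in>Cent G - {carrier G}. card (Q C - {center G})))" by (simp only: of_nat_le_iff)
  also have "\<dots> = 1 + (\<Sum>C\<in>Cent G - {carrier G}. real (card (Q C - {center G})))" by simp
  also have "\<dots> \<le> 1 + (\<Sum>C\<in>Cent G - {carrier G}. M - 1)"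
  proof (intro add_left_mono sum_mono)
    fix C assume C: "C \<in> Cent G - {carrier G}"
    have "Suc (card (Q C - {center G})) = card (Q C)"
      using C finQ zQ by (intro card_Suc_Diff1) auto
    then show "real (card (Q C - {center G})) \<le> M - 1" using M[of C] C by (simp add: Q_def)
  qed
  also have "\<dots> = 1 + (real (card (Cent G)) - 1) * (M - 1)" by (simp add: c1)
  finally show "real (order (G Mod center G)) \<le> 1 + (real (card (Cent G)) - 1) * (M - 1)" .
qed

lemma three_le_card_Cent:
  assumes fin: "finite (Cent G)" and nonabelian: "\<not> comm_group G"
  shows "3 \<le> card (Cent G)"
proof -
  obtain x y where xy: "x \<in> carrier G" "y \<in> carrier G" "x \<otimes> y \<noteq> y \<otimes> x"
    using nonabelian group_comm_groupI by blast
  let ?S = "{centralizer G \<one>, centralizer G x, centralizer G y}"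
  have "x \<in> centralizer G x" "x \<notin> centralizer G y" "y \<notin> centralizer G x"
    "x \<in> centralizer G \<one>" "y \<in> centralizer G \<one>"
    using xy by (auto simp: centralizer_def)
  then have "card ?S = 3" by (auto simp: card_insert_if)
  moreover have "?S \<subseteq> Cent G" using xy by (auto simp: Cent_def)
  ultimately show ?thesis using card_mono[OF fin, of ?S] by simp
qed

end

theorem theorem2p14:
  fixes G :: "('a, 'b) monoid_scheme" and n :: nat
  assumes "group G"
    and "\<not> comm_group G"
    and "n_centralizer n G"
  shows "finite (carrier (G Mod center G)) \<and>
    (n \<le> 12 \<longrightarrow> real (order (G Mod center G)) \<le> (real n - 2) ^ 2) \<and>
    (n > 12 \<longrightarrow> real (order (G Mod center G)) \<le> 2 * (real n - 4) powr (log 2 (real n - 4)))"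
proof -
  interpret group G by (rule assms(1))
  have fin: "finite (Cent G)" and n: "n = card (Cent G)"
    using assms(3) by (auto simp: n_centralizer_def)
  have n3: "3 \<le> n" using three_le_card_Cent[OF fin assms(2)] n by simp
  let ?q = "\<lambda>C. card ((\<lambda>a. center G #>\<^bsub>G\<^esub> a) ` common_centralizer C)"
  note index = abelian_subgroup.card_image_center_le[OF abelian_subgroup_common_centralizer fin n n3]
  have small: "finite (carrier (G Mod center G))"
    "real (order (G Mod center G)) \<le> (real n - 2) ^ 2" if n12: "n \<le> 12"
  proof -
    have M: "real (?q C) \<le> real n - 2" if "C \<in> Cent G" for C
      using index(1)[OF that n12] n3 by linarith
    show "finite (carrier (G Mod center G))" by (rule order_Mod_center_le(1)[OF fin M])
    have "real (order (G Mod center G)) \<le> 1 + (real n - 1) * (real n - 2 - 1)"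
      using order_Mod_center_le(2)[OF fin M] n by simp
    also have "\<dots> = (real n - 2) ^ 2" by (simp add: power2_eq_square algebra_simps)
    finally show "real (order (G Mod center G)) \<le> (real n - 2) ^ 2" .
  qed
  let ?L = "log 2 (real n - 4)"
  have large: "finite (carrier (G Mod center G))"
    "real (order (G Mod center G)) \<le> 2 * (real n - 4) powr ?L" if n12: "12 < n"
  proof -
    let ?M = "(real n - 4) powr (?L - 1)"
    have M: "real (?q C) \<le> ?M" if "C \<in> Cent G" for C
      using index(2)[OF that n12] .
    show "finite (carrier (G Mod center G))" by (rule order_Mod_center_le(1)[OF fin M])
    have "real (order (G Mod center G)) \<le> 1 + (real n - 1) * (?M - 1)"
      using order_Mod_center_le(2)[OF fin M] n by simp
    also have "\<dots> \<le> (real n - 1) * ?M" using n12 by (simp add: algebra_simps)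
    also have "\<dots> \<le> (2 * (real n - 4)) * ?M" using n12 by (intro mult_right_mono) auto
    also have "\<dots> = 2 * (real n - 4) powr ?L" using n12 by (simp add: powr_diff del: distrib_left_numeral left_diff_distrib_numeral right_diff_distrib_numeral)
    finally show "real (order (G Mod center G)) \<le> 2 * (real n - 4) powr ?L" .
  qed
  show ?thesis using small large by (cases "n \<le> 12") auto
qed

end
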